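(* Let $a,b$ be positive integers, and let $G$ be a triangle-free graph with $n$ vertices and maximum degree $\Delta < \frac{n}{2}$. If $\lfloor \frac{n}{2} \rfloor \geq \max\{a,b\}+1$, then $n(S_{a,b},K_{\lfloor n/2\rfloor,\lceil n/2\rceil}) > n(S_{a,b},G)$.
   Context: Graphs are finite and simple. For graphs $H$ and $G$, $n(H,G)$ denotes the number of (not necessarily induced) subgraphs of $G$ isomorphic to $H$. The star of degree $a$ is the complete bipartite graph $K_{1,a}$, whose central vertex is the vertex of the part of size $1$. The double star $S_{a,b}$ is the graph formed from disjoint stars $K_{1,a}$ and $K_{1,b}$ by joining their central vertices by an edge (so $S_{a,b}$ has $a+b+2$ vertices and, for example, $S_{1,1}$ is the path on $4$ vertices). $K_{p,q}$ is the complete bipartite graph with parts of sizes $p$ and $q$. *)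

theory Defs
  imports Complex_Main
begin

datatype 'a ugraph = Graph (verts: "'a set") (edges: "'a set set")

definition simple_graph :: "'a ugraph \<Rightarrow> bool" where
  "simple_graph G \<longleftrightarrow> finite (verts G) \<and> (\<forall>e \<in> edges G. e \<subseteq> verts G \<and> card e = 2)"

definition adjacent :: "'a ugraph \<Rightarrow> 'a \<Rightarrow> 'a \<Rightarrow> bool" where
  "adjacent G x y \<longleftrightarrow> {x, y} \<in> edges G"

definition degree :: "'a ugraph \<Rightarrow> 'a \<Rightarrow> nat" where
  "degree G x = card {y \<in> verts G. adjacent G x y}"

text \<open>Meaningful only for graphs with at least one vertex.\<close>

definition max_degree :: "'a ugraph \<Rightarrow> nat" where
  "max_degree G = Max (degree G ` verts G)"

definition triangle_free :: "'a ugraph \<Rightarrow> bool" where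
  "triangle_free G \<longleftrightarrow> \<not> (\<exists>x y z. adjacent G x y \<and> adjacent G y z \<and> adjacent G x z)"

definition subgraph :: "'a ugraph \<Rightarrow> 'a ugraph \<Rightarrow> bool" where
  "subgraph S G \<longleftrightarrow> simple_graph S \<and> verts S \<subseteq> verts G \<and> edges S \<subseteq> edges G"

definition isomorphic :: "'a ugraph \<Rightarrow> 'b ugraph \<Rightarrow> bool" where
  "isomorphic G H \<longleftrightarrow>
     (\<exists>f. bij_betw f (verts G) (verts H) \<and> (\<lambda>e. f ` e) ` edges G = edges H)"

definition num_copies :: "'b ugraph \<Rightarrow> 'a ugraph \<Rightarrow> nat" where
  "num_copies H G = card {S. subgraph S G \<and> isomorphic H S}"

definition complete_bipartite :: "nat \<Rightarrow> nat \<Rightarrow> (nat + nat) ugraph" where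
  "complete_bipartite p q =
     Graph ({..<p} <+> {..<q}) {{Inl i, Inr j} | i j. i < p \<and> j < q}"

definition star :: "nat \<Rightarrow> (nat + nat) ugraph" where
  "star a = complete_bipartite 1 a"

definition star_center :: "nat + nat" where
  "star_center = Inl 0"

definition disjoint_union :: "'a ugraph \<Rightarrow> 'b ugraph \<Rightarrow> ('a + 'b) ugraph" where
  "disjoint_union G H =
     Graph (verts G <+> verts H) ((\<lambda>e. Inl ` e) ` edges G \<union> (\<lambda>e. Inr ` e) ` edges H)"

definition add_edge :: "'a \<Rightarrow> 'a \<Rightarrow> 'a ugraph \<Rightarrow> 'a ugraph" where
  "add_edge x y G = Graph (verts G) (insert {x, y} (edges G))"

definition double_star :: "nat \<Rightarrow> nat \<Rightarrow> ((nat + nat) + (nat + nat)) ugraph" where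
  "double_star a b =
     add_edge (Inl star_center) (Inr star_center) (disjoint_union (star a) (star b))"

lemma simple_graph_complete_bipartite: "simple_graph (complete_bipartite p q)"
  by (auto simp: simple_graph_def complete_bipartite_def)

lemma simple_graph_double_star: "simple_graph (double_star a b)"
  by (auto simp: simple_graph_def double_star_def add_edge_def disjoint_union_def
      star_def star_center_def complete_bipartite_def)

lemma card_verts_double_star: "card (verts (double_star a b)) = a + b + 2"
  by (simp add: double_star_def add_edge_def disjoint_union_def star_def
      complete_bipartite_def card_Plus)

end

theory Submission
  imports Defs "HOL-Library.FuncSet"
begin

text \<open>
  Counting embeddings (injective homomorphisms) instead of copies changes nothing in the
  comparison: every copy of \<open>H\<close> in any graph is the image of exactly as many embeddings as \<open>H\<close>
  has automorphisms (lemma \<open>card_embeddings\<close>). This avoids having to recover the two centres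
  from a copy, and treats \<open>a = b\<close>, where the centres can be swapped, like \<open>a \<noteq> b\<close>.

  Call an edge with a chosen direction a dart. An embedding of the double star sends the central
  edge to a dart \<open>(u, v)\<close> and the leaves injectively to neighbours of \<open>u\<close> other than \<open>v\<close> and of
  \<open>v\<close> other than \<open>u\<close>. In a triangle-free graph adjacent vertices have no common neighbour, so
  the two choices of leaves are independent, and the number of embeddings is the sum over all
  darts \<open>(u, v)\<close> of a product of falling factorials of \<open>degree G u - 1\<close> and \<open>degree G v - 1\<close>
  (lemma \<open>card_embeddings_double_star\<close>).

  Let \<open>p = \<lfloor>n/2\<rfloor>\<close>, \<open>q = \<lceil>n/2\<rceil>\<close>, and let \<open>d < n/2\<close> be the maximum degree of \<open>G\<close>. Then
  \<open>d \<le> p\<close>, so each dart of \<open>G\<close> contributes at most what a dart with both ends of degree \<open>p\<close>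
  would. Each dart of the complete bipartite graph contributes at least that much, its degrees
  being \<open>p\<close> and \<open>q \<ge> p\<close>, and the amount is positive as \<open>p > max a b\<close>. The strict inequality
  comes from the number of darts: \<open>G\<close> has at most \<open>n d\<close>, and \<open>n d < 2 p q\<close>.
\<close>

section \<open>Copies and embeddings\<close>

text \<open>
  Embeddings and isomorphisms are taken to be \<open>undefined\<close> outside \<open>verts H\<close>, so that distinct
  functions really are distinct embeddings and can be counted.
\<close>

definition embeddings :: "'b ugraph \<Rightarrow> 'a ugraph \<Rightarrow> ('b \<Rightarrow> 'a) set" where
  "embeddings H G =
     {f \<in> verts H \<rightarrow>\<^sub>E verts G. inj_on f (verts H) \<and> (\<forall>e \<in> edges H. f ` e \<in> edges G)}"

definition isos :: "'b ugraph \<Rightarrow> 'a ugraph \<Rightarrow> ('b \<Rightarrow> 'a) set" where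
  "isos H S =
     {f \<in> extensional (verts H).
        bij_betw f (verts H) (verts S) \<and> (\<lambda>e. f ` e) ` edges H = edges S}"

lemma simple_graph_edge_subset: "simple_graph G \<Longrightarrow> e \<in> edges G \<Longrightarrow> e \<subseteq> verts G"
  by (simp add: simple_graph_def)

lemma image_edges_restrict:
  assumes "simple_graph H"
  shows "(\<lambda>e. restrict f (verts H) ` e) ` edges H = (\<lambda>e. f ` e) ` edges H"
  using simple_graph_edge_subset[OF assms] by (auto intro!: image_cong)

lemma isomorphic_iff_isos_nonempty:
  assumes "simple_graph H"
  shows "isomorphic H S \<longleftrightarrow> isos H S \<noteq> {}"
proof
  assume "isomorphic H S"
  then obtain f where "bij_betw f (verts H) (verts S)" "(\<lambda>e. f ` e) ` edges H = edges S"
    by (auto simp: isomorphic_def)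
  then have "restrict f (verts H) \<in> isos H S"
    unfolding isos_def mem_Collect_eq image_edges_restrict[OF assms] bij_betw_restrict_eq
    by simp
  then show "isos H S \<noteq> {}" by blast
qed (auto simp: isos_def isomorphic_def)

text \<open>
  Composition with one fixed isomorphism from \<open>H\<close> to \<open>S\<close> turns the automorphisms of \<open>H\<close> into
  the isomorphisms from \<open>H\<close> to \<open>S\<close>, and composition with its inverse undoes this.
\<close>

lemma card_isos:
  assumes H: "simple_graph H" and "isomorphic H S"
  shows "card (isos H S) = card (isos H H)"
proof -
  obtain f where "f \<in> isos H S"
    using assms isomorphic_iff_isos_nonempty by blast
  then have f: "bij_betw f (verts H) (verts S)" "(\<lambda>e. f ` e) ` edges H = edges S"
    by (auto simp: isos_def)
  define f' where "f' = inv_into (verts H) f"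
  have f': "bij_betw f' (verts S) (verts H)"
    unfolding f'_def by (rule bij_betw_inv_into[OF f(1)])
  have cancel: "f' (f x) = x" if "x \<in> verts H" for x
    using f(1) that by (simp add: f'_def bij_betw_inv_into_left)
  have cancel': "f (f' y) = y" if "y \<in> verts S" for y
    using f(1) that by (simp add: f'_def bij_betw_inv_into_right)
  have "f' ` f ` e = e" if "e \<in> edges H" for e
    using simple_graph_edge_subset[OF H that] cancel by (force simp: image_image)
  then have f'_edges: "(\<lambda>e. f' ` e) ` edges S = edges H"
    by (force simp: f(2)[symmetric] image_image)
  have "bij_betw (compose (verts H) f) (isos H H) (isos H S)"
  proof (rule bij_betw_byWitness[where f' = "compose (verts H) f'"])
    show "\<forall>g\<in>isos H H. compose (verts H) f' (compose (verts H) f g) = g"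
    proof
      fix g assume "g \<in> isos H H"
      then show "compose (verts H) f' (compose (verts H) f g) = g"
        by (intro extensionalityI[where A = "verts H"])
          (auto simp: isos_def compose_def bij_betw_apply cancel)
    qed
    show "\<forall>h\<in>isos H S. compose (verts H) f (compose (verts H) f' h) = h"
    proof
      fix h assume "h \<in> isos H S"
      then show "compose (verts H) f (compose (verts H) f' h) = h"
        by (intro extensionalityI[where A = "verts H"])
          (auto simp: isos_def compose_def bij_betw_apply cancel')
    qed
    show "compose (verts H) f ` isos H H \<subseteq> isos H S"
    proof (clarsimp simp: isos_def)
      fix g assume g: "bij_betw g (verts H) (verts H)" "(\<lambda>e. g ` e) ` edges H = edges H"
      have "(\<lambda>e. compose (verts H) f g ` e) ` edges H = (\<lambda>e. (f \<circ> g) ` e) ` edges H"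
        unfolding compose_def image_edges_restrict[OF H] by simp
      also have "\<dots> = (\<lambda>e. f ` e) ` (\<lambda>e. g ` e) ` edges H"
        by (simp add: image_image image_comp)
      finally show "bij_betw (compose (verts H) f g) (verts H) (verts S) \<and>
          (\<lambda>e. compose (verts H) f g ` e) ` edges H = edges S"
        using g f bij_betw_trans[OF g(1) f(1)]
        by (simp add: bij_betw_compose)
    qed
    show "compose (verts H) f' ` isos H S \<subseteq> isos H H"
    proof (clarsimp simp: isos_def)
      fix g assume g: "bij_betw g (verts H) (verts S)" "(\<lambda>e. g ` e) ` edges H = edges S"
      have "(\<lambda>e. compose (verts H) f' g ` e) ` edges H = (\<lambda>e. (f' \<circ> g) ` e) ` edges H"
        unfolding compose_def image_edges_restrict[OF H] by simp
      also have "\<dots> = (\<lambda>e. f' ` e) ` (\<lambda>e. g ` e) ` edges H"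
        by (simp add: image_image image_comp)
      finally show "bij_betw (compose (verts H) f' g) (verts H) (verts H) \<and>
          (\<lambda>e. compose (verts H) f' g ` e) ` edges H = edges H"
        using g f' f'_edges by (simp add: bij_betw_compose)
    qed
  qed
  then show ?thesis by (rule bij_betw_same_card[symmetric])
qed

lemma finite_isos_self:
  assumes "simple_graph H"
  shows "finite (isos H H)"
proof (rule finite_subset)
  show "isos H H \<subseteq> verts H \<rightarrow>\<^sub>E verts H"
    by (auto simp: isos_def PiE_def bij_betw_apply)
  show "finite (verts H \<rightarrow>\<^sub>E verts H)"
    using assms by (intro finite_PiE) (auto simp: simple_graph_def)
qed

lemma card_isos_self_pos:
  assumes "simple_graph H"
  shows "card (isos H H) > 0"
proof -
  have "isomorphic H H"
    unfolding isomorphic_def by (rule exI[of _ id]) simp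
  then show ?thesis
    using assms by (simp add: card_gt_0_iff finite_isos_self isomorphic_iff_isos_nonempty)
qed

text \<open>
  An embedding is the same thing as an isomorphism onto its image, so sorting the embeddings by
  their images partitions them into the sets of isomorphisms onto the copies.
\<close>

lemma embeddings_eq_UN_isos:
  assumes H: "simple_graph H"
  shows "embeddings H G = (\<Union>S \<in> {S. subgraph S G \<and> isomorphic H S}. isos H S)"
proof (intro equalityI subsetI)
  fix f assume f: "f \<in> embeddings H G"
  let ?S = "Graph (f ` verts H) ((\<lambda>e. f ` e) ` edges H)"
  have inj: "inj_on f (verts H)" using f by (simp add: embeddings_def)
  have iso: "f \<in> isos H ?S"
    using f by (auto simp: embeddings_def isos_def PiE_def bij_betw_def)
  have "card (f ` e) = 2" if "e \<in> edges H" for e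
    using H that card_image[OF inj_on_subset[OF inj]] by (auto simp: simple_graph_def)
  then have "subgraph ?S G"
    using H f by (auto simp: subgraph_def simple_graph_def embeddings_def)
  with iso show "f \<in> (\<Union>S \<in> {S. subgraph S G \<and> isomorphic H S}. isos H S)"
    using isomorphic_iff_isos_nonempty[OF H] by blast
next
  fix f assume "f \<in> (\<Union>S \<in> {S. subgraph S G \<and> isomorphic H S}. isos H S)"
  then obtain S where "subgraph S G" "f \<in> isos H S" by blast
  then show "f \<in> embeddings H G"
    by (fastforce simp: embeddings_def isos_def subgraph_def bij_betw_def PiE_def)
qed

lemma isos_disjoint:
  assumes "S \<noteq> T"
  shows "isos H S \<inter> isos H T = {}"
  using assms by (cases S; cases T) (auto simp: isos_def bij_betw_def)

lemma finite_subgraphs: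
  assumes "simple_graph G"
  shows "finite {S. subgraph S G}"
proof (rule finite_subset)
  show "{S. subgraph S G} \<subseteq> case_prod Graph ` (Pow (verts G) \<times> Pow (edges G))"
  proof
    fix S assume "S \<in> {S. subgraph S G}"
    then show "S \<in> case_prod Graph ` (Pow (verts G) \<times> Pow (edges G))"
      by (cases S) (force simp: subgraph_def)
  qed
  have "edges G \<subseteq> Pow (verts G)"
    using simple_graph_edge_subset[OF assms] by blast
  then have "finite (edges G)"
    using assms finite_subset by (auto simp: simple_graph_def)
  then show "finite (case_prod Graph ` (Pow (verts G) \<times> Pow (edges G)))"
    using assms by (simp add: simple_graph_def)
qed

text \<open>
  The factor \<open>card (isos H H)\<close> does not depend on \<open>G\<close>, hence cancels when the numbers of copies
  of \<open>H\<close> in two graphs are compared.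
\<close>

lemma card_embeddings:
  assumes H: "simple_graph H" and G: "simple_graph G"
  shows "card (embeddings H G) = card (isos H H) * num_copies H G"
proof -
  let ?C = "{S. subgraph S G \<and> isomorphic H S}"
  have "card (isos H S) > 0" if "S \<in> ?C" for S
    using that card_isos[OF H, of S] card_isos_self_pos[OF H] by simp
  then have "card (embeddings H G) = (\<Sum>S\<in>?C. card (isos H S))"
    unfolding embeddings_eq_UN_isos[OF H]
    using finite_subgraphs[OF G]
    by (intro card_UN_disjoint ballI impI isos_disjoint) (auto intro: card_ge_0_finite)
  also have "\<dots> = (\<Sum>S\<in>?C. card (isos H H))"
    using card_isos[OF H] by (intro sum.cong) auto
  finally show ?thesis by (simp add: num_copies_def mult.commute)
qed

section \<open>Double stars in triangle-free graphs\<close>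

definition neighbours :: "'a ugraph \<Rightarrow> 'a \<Rightarrow> 'a set" where
  "neighbours G x = {y \<in> verts G. adjacent G x y}"

lemma degree_eq_card_neighbours: "degree G x = card (neighbours G x)"
  by (simp add: degree_def neighbours_def)

lemma adjacent_commute: "adjacent G x y \<longleftrightarrow> adjacent G y x"
  by (simp add: adjacent_def insert_commute)

lemma finite_neighbours: "simple_graph G \<Longrightarrow> finite (neighbours G x)"
  by (simp add: neighbours_def simple_graph_def)

lemma neighbours_iff:
  assumes "simple_graph G"
  shows "y \<in> neighbours G x \<longleftrightarrow> {x, y} \<in> edges G"
  using simple_graph_edge_subset[OF assms] by (auto simp: neighbours_def adjacent_def)

lemma self_notin_neighbours:
  assumes "simple_graph G"
  shows "x \<notin> neighbours G x"
  using assms by (auto simp: neighbours_iff simple_graph_def)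

definition injections :: "nat \<Rightarrow> 'a set \<Rightarrow> (nat \<Rightarrow> 'a) set" where
  "injections k B = {f \<in> {..<k} \<rightarrow>\<^sub>E B. inj_on f {..<k}}"

text \<open>
  The falling factorial \<open>d (d - 1) \<dots> (d - k + 1)\<close>. Truncated subtraction is harmless: for
  \<open>k > d\<close> the factor at \<open>i = d\<close> vanishes.
\<close>

definition falling :: "nat \<Rightarrow> nat \<Rightarrow> nat" where
  "falling d k = (\<Prod>i<k. d - i)"

lemma card_injections:
  assumes "finite B"
  shows "card (injections k B) = falling (card B) k"
  using card_inj_on_subset_funcset[of "{..<k}" B "{..<k}"] assms
  by (simp add: injections_def falling_def lessThan_atLeast0)

lemma finite_injections: "finite B \<Longrightarrow> finite (injections k B)"
  by (simp add: injections_def finite_PiE)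

lemma falling_mono: "d \<le> d' \<Longrightarrow> falling d k \<le> falling d' k"
  unfolding falling_def by (intro prod_mono) auto

lemma falling_pos: "k \<le> d \<Longrightarrow> falling d k > 0"
  unfolding falling_def by (intro prod_pos) auto

lemma verts_double_star:
  "verts (double_star a b) =
     {Inl (Inl 0), Inr (Inl 0)} \<union> (\<lambda>i. Inl (Inr i)) ` {..<a} \<union> (\<lambda>j. Inr (Inr j)) ` {..<b}"
  by (auto simp: double_star_def add_edge_def disjoint_union_def star_def complete_bipartite_def)

lemma edges_star: "edges (star a) = (\<lambda>i. {Inl 0, Inr i}) ` {..<a}"
  by (auto simp: star_def complete_bipartite_def)

lemma edges_double_star:
  "edges (double_star a b) =
     {{Inl (Inl 0), Inr (Inl 0)}}
     \<union> (\<lambda>i. {Inl (Inl 0), Inl (Inr i)}) ` {..<a}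
     \<union> (\<lambda>j. {Inr (Inl 0), Inr (Inr j)}) ` {..<b}"
  by (simp add: double_star_def add_edge_def disjoint_union_def star_center_def edges_star
      image_image)

text \<open>
  Assembles a function on the double star from the images \<open>c\<close> of the two centres and the
  functions \<open>l\<close> placing the leaves at the first and at the second centre.
\<close>

definition double_star_map ::
    "nat \<Rightarrow> nat \<Rightarrow> 'a \<times> 'a \<Rightarrow> (nat \<Rightarrow> 'a) \<times> (nat \<Rightarrow> 'a) \<Rightarrow> (nat + nat) + (nat + nat) \<Rightarrow> 'a" where
  "double_star_map a b c l =
     restrict (case_sum (case_sum (\<lambda>_. fst c) (fst l)) (case_sum (\<lambda>_. snd c) (snd l)))
       (verts (double_star a b))"

text \<open>
  The sum runs over the darts of \<open>G\<close>. Given the images \<open>u\<close> and \<open>v\<close> of the centres, the leaves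
  at the first centre can be placed injectively on \<open>neighbours G u - {v}\<close> and those at the second
  on \<open>neighbours G v - {u}\<close>. These two sets are disjoint because \<open>G\<close> has no triangle, so every pair
  of placements gives an embedding.
\<close>

lemma card_embeddings_double_star:
  assumes G: "simple_graph G" and tf: "triangle_free G"
  shows "card (embeddings (double_star a b) G) =
    (\<Sum>(u, v) \<in> Sigma (verts G) (neighbours G).
       falling (degree G u - 1) a * falling (degree G v - 1) b)"
proof -
  let ?D = "double_star a b"
  let ?E = "Sigma (verts G) (neighbours G)"
  let ?L = "\<lambda>(u, v). injections a (neighbours G u - {v}) \<times> injections b (neighbours G v - {u})"
  let ?split = "\<lambda>f :: (nat + nat) + (nat + nat) \<Rightarrow> 'a. ((f (Inl (Inl 0)), f (Inr (Inl 0))),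
    (\<lambda>i\<in>{..<a}. f (Inl (Inr i))), (\<lambda>j\<in>{..<b}. f (Inr (Inr j))))"
  have "bij_betw (\<lambda>(c, l). double_star_map a b c l) (Sigma ?E ?L) (embeddings ?D G)"
  proof (rule bij_betw_byWitness[where f' = ?split])
    show "(\<lambda>(c, l). double_star_map a b c l) ` Sigma ?E ?L \<subseteq> embeddings ?D G"
    proof clarify
      fix u v g h
      assume uv: "u \<in> verts G" "v \<in> neighbours G u"
        and g: "g \<in> injections a (neighbours G u - {v})"
        and h: "h \<in> injections b (neighbours G v - {u})"
      have disjoint: "neighbours G u \<inter> neighbours G v = {}"
        using uv tf by (auto simp: neighbours_def triangle_free_def adjacent_commute[of G v])
      have g': "g i \<in> neighbours G u" "g i \<noteq> v" if "i < a" for i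
        using g that by (auto simp: injections_def PiE_iff)
      have h': "h j \<in> neighbours G v" "h j \<noteq> u" if "j < b" for j
        using h that by (auto simp: injections_def PiE_iff)
      have gh: "g i \<noteq> h j" if "i < a" "j < b" for i j
        using g'(1)[OF that(1)] h'(1)[OF that(2)] disjoint by auto
      have gu: "g i \<noteq> u" if "i < a" for i
        using g'(1)[OF that] self_notin_neighbours[OF G] by auto
      have hv: "h j \<noteq> v" if "j < b" for j
        using h'(1)[OF that] self_notin_neighbours[OF G] by auto
      have ne: "u \<noteq> v" using uv self_notin_neighbours[OF G] by auto
      have ginj: "inj_on g {..<a}" and hinj: "inj_on h {..<b}"
        using g h by (auto simp: injections_def)
      let ?f = "double_star_map a b (u, v) (g, h)"
      have "?f \<in> verts ?D \<rightarrow>\<^sub>E verts G"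
        using uv g' h' by (auto simp: double_star_map_def verts_double_star neighbours_def)
      moreover have "inj_on ?f (verts ?D)"
        unfolding double_star_map_def inj_on_restrict_eq
        using g'(2) h'(2) gh gu hv ne ginj hinj
        by (auto simp: verts_double_star inj_on_def; metis)
      moreover have "?f ` e \<in> edges G" if "e \<in> edges ?D" for e
        using that uv g' h'
        by (auto simp: edges_double_star double_star_map_def verts_double_star neighbours_iff[OF G])
      ultimately show "?f \<in> embeddings ?D G"
        by (simp add: embeddings_def)
    qed
    show "\<forall>f\<in>embeddings ?D G. (\<lambda>(c, l). double_star_map a b c l) (?split f) = f"
    proof
      fix f assume f: "f \<in> embeddings ?D G"
      show "(\<lambda>(c, l). double_star_map a b c l) (?split f) = f"
        unfolding split_conv
        by (rule extensionalityI[where A = "verts ?D"])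
          (use f in \<open>auto simp: double_star_map_def embeddings_def PiE_def verts_double_star\<close>)
    qed
    show "?split ` embeddings ?D G \<subseteq> Sigma ?E ?L"
    proof (rule image_subsetI)
      fix f assume f: "f \<in> embeddings ?D G"
      then have inj: "inj_on f (verts ?D)" and edge: "\<And>e. e \<in> edges ?D \<Longrightarrow> f ` e \<in> edges G"
        and vert: "\<And>x. x \<in> verts ?D \<Longrightarrow> f x \<in> verts G"
        by (auto simp: embeddings_def)
      have "f (Inr (Inl 0)) \<in> neighbours G (f (Inl (Inl 0)))"
        using edge[of "{Inl (Inl 0), Inr (Inl 0)}"] by (simp add: edges_double_star neighbours_iff[OF G])
      moreover have "f (Inl (Inr i)) \<in> neighbours G (f (Inl (Inl 0)))" if "i < a" for i
        using edge[of "{Inl (Inl 0), Inl (Inr i)}"] that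
        by (simp add: edges_double_star neighbours_iff[OF G])
      moreover have "f (Inr (Inr j)) \<in> neighbours G (f (Inr (Inl 0)))" if "j < b" for j
        using edge[of "{Inr (Inl 0), Inr (Inr j)}"] that
        by (simp add: edges_double_star neighbours_iff[OF G])
      moreover have "f (Inl (Inr i)) \<noteq> f (Inr (Inl 0))" if "i < a" for i
        using inj_onD[OF inj, of "Inl (Inr i)" "Inr (Inl 0)"] that by (auto simp: verts_double_star)
      moreover have "f (Inr (Inr j)) \<noteq> f (Inl (Inl 0))" if "j < b" for j
        using inj_onD[OF inj, of "Inr (Inr j)" "Inl (Inl 0)"] that by (auto simp: verts_double_star)
      moreover have "inj_on (\<lambda>i. f (Inl (Inr i))) {..<a}"
      proof (rule inj_onI)
        fix i j assume "i \<in> {..<a}" "j \<in> {..<a}" "f (Inl (Inr i)) = f (Inl (Inr j))"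
        then show "i = j"
          using inj_onD[OF inj, of "Inl (Inr i)" "Inl (Inr j)"] by (auto simp: verts_double_star)
      qed
      moreover have "inj_on (\<lambda>j. f (Inr (Inr j))) {..<b}"
      proof (rule inj_onI)
        fix i j assume "i \<in> {..<b}" "j \<in> {..<b}" "f (Inr (Inr i)) = f (Inr (Inr j))"
        then show "i = j"
          using inj_onD[OF inj, of "Inr (Inr i)" "Inr (Inr j)"] by (auto simp: verts_double_star)
      qed
      ultimately show "?split f \<in> Sigma ?E ?L"
        using vert[of "Inl (Inl 0)"] by (auto simp: injections_def verts_double_star)
    qed
    show "\<forall>x\<in>Sigma ?E ?L. ?split ((\<lambda>(c, l). double_star_map a b c l) x) = x"
      by (auto simp: double_star_map_def verts_double_star injections_def PiE_def
          extensional_def fun_eq_iff)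
  qed
  then have "card (embeddings ?D G) = card (Sigma ?E ?L)"
    by (rule bij_betw_same_card[symmetric])
  also have "\<dots> = (\<Sum>c\<in>?E. card (?L c))"
    using G by (intro card_SigmaI)
      (auto simp: simple_graph_def finite_neighbours finite_injections)
  also have "\<dots> = (\<Sum>(u, v)\<in>?E. falling (degree G u - 1) a * falling (degree G v - 1) b)"
  proof (rule sum.cong, simp, clarify)
    fix u v assume "u \<in> verts G" "v \<in> neighbours G u"
    then have "v \<in> neighbours G u" "u \<in> neighbours G v"
      by (auto simp: neighbours_def adjacent_commute[of G v])
    then show "card (injections a (neighbours G u - {v}) \<times> injections b (neighbours G v - {u})) =
        falling (degree G u - 1) a * falling (degree G v - 1) b"
      by (simp add: card_cartesian_product card_injections finite_neighbours[OF G]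
          degree_eq_card_neighbours)
  qed
  finally show ?thesis .
qed

lemma card_darts:
  assumes "simple_graph G"
  shows "card (Sigma (verts G) (neighbours G)) = (\<Sum>u\<in>verts G. degree G u)"
  using assms
  by (subst card_SigmaI) (auto simp: simple_graph_def finite_neighbours degree_eq_card_neighbours)

section \<open>The extremal comparison\<close>

lemma triangle_free_complete_bipartite: "triangle_free (complete_bipartite p q)"
  unfolding triangle_free_def
proof clarify
  fix x y z :: "nat + nat"
  assume "adjacent (complete_bipartite p q) x y" "adjacent (complete_bipartite p q) y z"
    "adjacent (complete_bipartite p q) x z"
  then show False
    by (cases x; cases y; cases z) (auto simp: adjacent_def complete_bipartite_def doubleton_eq_iff)
qed

lemma neighbours_complete_bipartite_Inl:
  "i < p \<Longrightarrow> neighbours (complete_bipartite p q) (Inl i) = Inr ` {..<q}"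
  by (auto simp: neighbours_def adjacent_def complete_bipartite_def doubleton_eq_iff)

lemma neighbours_complete_bipartite_Inr:
  "j < q \<Longrightarrow> neighbours (complete_bipartite p q) (Inr j) = Inl ` {..<p}"
  by (auto simp: neighbours_def adjacent_def complete_bipartite_def doubleton_eq_iff)

lemma degree_complete_bipartite:
  "i < p \<Longrightarrow> degree (complete_bipartite p q) (Inl i) = q"
  "j < q \<Longrightarrow> degree (complete_bipartite p q) (Inr j) = p"
  by (simp_all add: degree_eq_card_neighbours neighbours_complete_bipartite_Inl
      neighbours_complete_bipartite_Inr card_image)

lemma verts_complete_bipartite: "verts (complete_bipartite p q) = {..<p} <+> {..<q}"
  by (simp add: complete_bipartite_def)

lemma card_darts_complete_bipartite:
  "card (Sigma (verts (complete_bipartite p q)) (neighbours (complete_bipartite p q))) = 2 * p * q"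
  unfolding card_darts[OF simple_graph_complete_bipartite]
  by (simp add: verts_complete_bipartite sum.Plus degree_complete_bipartite)

lemma embeddings_double_star_upper:
  assumes G: "simple_graph G" "triangle_free G"
    and deg: "\<And>x. x \<in> verts G \<Longrightarrow> degree G x \<le> d"
  shows "card (embeddings (double_star a b) G)
    \<le> card (verts G) * d * (falling (d - 1) a * falling (d - 1) b)"
proof -
  let ?F = "falling (d - 1) a * falling (d - 1) b"
  have "card (embeddings (double_star a b) G) \<le> (\<Sum>_ \<in> Sigma (verts G) (neighbours G). ?F)"
    unfolding card_embeddings_double_star[OF G]
    by (intro sum_mono, clarify, intro mult_mono falling_mono diff_le_mono deg)
      (auto simp: neighbours_def)
  also have "\<dots> = (\<Sum>u\<in>verts G. degree G u) * ?F"
    by (simp add: card_darts[OF G(1)])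
  also have "\<dots> \<le> card (verts G) * d * ?F"
    using sum_bounded_above[of "verts G" "degree G" d] deg by (intro mult_right_mono) auto
  finally show ?thesis .
qed

lemma embeddings_double_star_complete_bipartite_lower:
  assumes "p \<le> q"
  shows "2 * p * q * (falling (p - 1) a * falling (p - 1) b)
    \<le> card (embeddings (double_star a b) (complete_bipartite p q))"
proof -
  let ?K = "complete_bipartite p q"
  let ?F = "falling (p - 1) a * falling (p - 1) b"
  have deg: "p \<le> degree ?K x" if "x \<in> verts ?K" for x
    using that assms by (auto simp: verts_complete_bipartite degree_complete_bipartite)
  have "2 * p * q * ?F = (\<Sum>_ \<in> Sigma (verts ?K) (neighbours ?K). ?F)"
    by (simp add: card_darts_complete_bipartite)
  also have "\<dots> \<le> card (embeddings (double_star a b) ?K)"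
    unfolding card_embeddings_double_star[OF simple_graph_complete_bipartite
        triangle_free_complete_bipartite]
    by (intro sum_mono, clarify, intro mult_mono falling_mono diff_le_mono deg)
      (auto simp: neighbours_def)
  finally show ?thesis .
qed

theorem theorem1:
  fixes a b n :: nat and G :: "'a ugraph"
  assumes "a \<ge> 1" and "b \<ge> 1"
    and "simple_graph G" and "triangle_free G" and "card (verts G) = n"
    and "real (max_degree G) < real n / 2"
    and "\<lfloor>real n / 2\<rfloor> \<ge> int (max a b) + 1"
  shows "num_copies (double_star a b) (complete_bipartite (nat \<lfloor>real n / 2\<rfloor>) (nat \<lceil>real n / 2\<rceil>))
           > num_copies (double_star a b) G"
proof -
  let ?D = "double_star a b"
  define p where "p = nat \<lfloor>real n / 2\<rfloor>"
  define q where "q = nat \<lceil>real n / 2\<rceil>"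
  define d where "d = max_degree G"
  let ?K = "complete_bipartite p q"
  let ?F = "\<lambda>d. falling (d - 1) a * falling (d - 1) b"
  have p: "p = n div 2"
    using floor_divide_of_nat_eq[of n 2, where ?'a = real] by (simp add: p_def)
  have "\<lceil>real n / 2\<rceil> = int (n - n div 2)"
  proof (cases "even n")
    case True
    then show ?thesis by (auto elim!: evenE)
  next
    case False
    then obtain m where "n = 2 * m + 1" using oddE by blast
    then show ?thesis by (auto intro!: ceiling_unique simp: field_simps)
  qed
  then have q: "q = n - n div 2" by (simp add: q_def)
  have large: "a \<le> p - 1" "b \<le> p - 1" "p \<ge> 1"
    using assms(7) by (auto simp: p_def)
  have d: "2 * d < n" using assms(6) by (simp add: d_def)
  have "degree G x \<le> d" if "x \<in> verts G" for x
    using assms(3) that by (auto simp: d_def max_degree_def simple_graph_def)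
  then have "card (embeddings ?D G) \<le> n * d * ?F d"
    using embeddings_double_star_upper[OF assms(3,4)] assms(5) by blast
  also have "\<dots> \<le> n * d * ?F p"
    using d p by (intro mult_left_mono mult_mono falling_mono diff_le_mono) auto
  also have "\<dots> < 2 * p * q * ?F p"
  proof -
    \<comment> \<open>For \<open>n = 2 m\<close> the slack is \<open>d \<le> m - 1\<close>; for \<open>n = 2 m + 1\<close> the degree \<open>d = m\<close> is possible,
      and the slack is only that \<open>2 m + 1 < 2 (m + 1)\<close>.\<close>
    have "n * d < 2 * p * q"
    proof (cases "even n")
      case True
      then obtain m where m: "n = 2 * m" by blast
      with d p q large have "d < m" "p = m" "q = m" "m > 0" by auto
      with m show ?thesis by simp
    next
      case False
      then obtain m where m: "n = 2 * m + 1" using oddE by blast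
      with d p q large have "d \<le> m" "p = m" "q = m + 1" "m > 0" by auto
      then have "n * d \<le> (2 * m + 1) * m" unfolding m by (intro mult_left_mono) auto
      also have "\<dots> < 2 * m * (m + 1)" using \<open>m > 0\<close> by simp
      finally show ?thesis using \<open>p = m\<close> \<open>q = m + 1\<close> by simp
    qed
    moreover have "?F p > 0" using large by (simp add: falling_pos)
    ultimately show ?thesis by simp
  qed
  also have "\<dots> \<le> card (embeddings ?D ?K)"
    using p q by (intro embeddings_double_star_complete_bipartite_lower) simp
  finally have "card (isos ?D ?D) * num_copies ?D G < card (isos ?D ?D) * num_copies ?D ?K"
    by (simp only: card_embeddings simple_graph_double_star simple_graph_complete_bipartite assms(3))
  then show ?thesis by (simp add: p_def q_def)
qed

end
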